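(* Let $\Sigma$ be a finite alphabet, let $d\ge 1$ and $n\ge 2d-1$ be integers, and let $(p(v))_{v\in\Sigma^n}$ be an (unconstrained) probability distribution on $\Sigma^n$, i.e. a family of non-negative real numbers (whose sum need not be $1$). For strings $u\in\Sigma^*$ with $|u|<n$ put $p(u):=\sum_{v\in\Sigma^{n-|u|}}p(uv)$. Then $$(p(v))_{v\in\Sigma^n}\in\mathrm{image}(\mathbf{g}_{n,d})$$ if and only if both of the following conditions hold: (a) $\det[p(w_jv_i)]_{1\le i,j\le d+1}=0$ for all choices of words $v_1,\dots,v_{d+1},w_1,\dots,w_{d+1}\in\Sigma^*$ of length at most $d-1$ (equivalently, $\mathrm{rk}\,\mathcal{P}_{p,d-1,d-1}\le d$); (b) $\mathrm{rk}\,\mathcal{P}_{p,\lceil n/2\rceil,\lfloor n/2\rfloor}=\mathrm{rk}\,\mathcal{P}_{p,\lfloor n/2\rfloor,\lceil n/2\rceil}=\mathrm{rk}\,\mathcal{P}_{p,d-1,d-1}$.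
   Context: $\Sigma^*=\bigcup_{t\ge0}\Sigma^t$ is the set of finite strings over $\Sigma$, including the empty string $\Box$ of length $0$; $|v|$ is the length of $v$, $wv$ is the concatenation of $w$ and $v$, and $\Sigma^{\le k}$ is the set of strings of length at most $k$. For integers $k,m\ge 0$ with $k+m\le n$, $\mathcal{P}_{p,k,m}:=[p(wv)]_{|v|\le k,\,|w|\le m}$ is the matrix with rows indexed by $v\in\Sigma^{\le k}$, columns indexed by $w\in\Sigma^{\le m}$, and $(v,w)$-entry $p(wv)$. The finite-dimensional model is the polynomial map $\mathbf{g}_{n,d}:\mathcal{S}^d\to\mathbb{C}^{|\Sigma|^n}$ given by $$((T_a)_{a\in\Sigma},x,y)\mapsto \big(y^TT_{a_n}\cdots T_{a_1}x\big)_{v=a_1\dots a_n\in\Sigma^n},$$ where $\mathcal{S}^d$ is the set of all tuples $((T_a)_{a\in\Sigma},x,y)$ with $T_a\in\mathbb{C}^{d\times d}$, $x,y\in\mathbb{C}^d$ and $y^T\sum_{a\in\Sigma}T_a=y^T$. *)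

theory Defs
  imports
    Complex_Main
    "HOL-Library.FuncSet"
    "Jordan_Normal_Form.Determinant"
    "Jordan_Normal_Form.DL_Rank"
begin

definition words :: "nat \<Rightarrow> 'a list set" where
  "words t = {v. length v = t}"

definition words_le :: "nat \<Rightarrow> 'a list set" where
  "words_le k = {v. length v \<le> k}"

(* Only the values of p on words n matter. For length u = n the sum has the single
   summand p (u @ []) = p u, so marginal n p agrees with p on words n.
   Values at words longer than n are meaningless and never used. *)
definition marginal :: "nat \<Rightarrow> ('a::finite list \<Rightarrow> real) \<Rightarrow> 'a list \<Rightarrow> real" where
  "marginal n p u = (\<Sum>v\<in>words (n - length u). p (u @ v))"

(* Library matrices are indexed by natural numbers, so the index set is enumerated in
   some fixed order; rank does not depend on the order of rows and columns. *)
definition enumeration :: "'b set \<Rightarrow> 'b list" where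
  "enumeration S = (SOME xs. distinct xs \<and> set xs = S)"

lemma enumeration:
  assumes "finite S"
  shows "distinct (enumeration S)" and "set (enumeration S) = S"
proof -
  have "\<exists>xs. distinct xs \<and> set xs = S"
    using finite_distinct_list[OF assms] by blast
  from someI_ex[OF this] show "distinct (enumeration S)" and "set (enumeration S) = S"
    by (simp_all add: enumeration_def)
qed

lemma finite_words: "finite (words t :: 'a::finite list set)"
  using finite_lists_length_eq[of "UNIV :: 'a set" t] by (simp add: words_def)

lemma finite_words_le: "finite (words_le k :: 'a::finite list set)"
  using finite_lists_length_le[of "UNIV :: 'a set" k] by (simp add: words_le_def)

(* The row index v is the suffix and the column index w is the prefix of the argument. *)
definition hankel :: "('a::finite list \<Rightarrow> real) \<Rightarrow> nat \<Rightarrow> nat \<Rightarrow> real mat" where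
  "hankel q k m =
     (let vs = enumeration (words_le k); ws = enumeration (words_le m)
      in mat (length vs) (length ws) (\<lambda>(i, j). q (ws ! j @ vs ! i)))"

definition mat_rank :: "real mat \<Rightarrow> nat" where
  "mat_rank A = vec_space.rank (dim_row A) A"

definition minors_vanish :: "('a::finite list \<Rightarrow> real) \<Rightarrow> nat \<Rightarrow> bool" where
  "minors_vanish q d \<longleftrightarrow>
     (\<forall>v w. (\<forall>i\<in>{1..d + 1}. v i \<in> words_le (d - 1) \<and> w i \<in> words_le (d - 1)) \<longrightarrow>
        det (mat (d + 1) (d + 1) (\<lambda>(i, j). q (w (j + 1) @ v (i + 1)))) = 0)"

(* T_{a_n} ... T_{a_1} for the word a_1 ... a_n: the first letter acts first. *)
definition word_mat :: "nat \<Rightarrow> ('a \<Rightarrow> complex mat) \<Rightarrow> 'a list \<Rightarrow> complex mat" where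
  "word_mat d T v = fold (\<lambda>a M. T a * M) v (1\<^sub>m d)"

(* Entrywise, since the type of matrices of all sizes has no zero and hence no sum. *)
definition letter_sum :: "nat \<Rightarrow> ('a::finite \<Rightarrow> complex mat) \<Rightarrow> complex mat" where
  "letter_sum d T = mat d d (\<lambda>(i, j). \<Sum>a\<in>UNIV. T a $$ (i, j))"

definition param_space :: "nat \<Rightarrow> (('a::finite \<Rightarrow> complex mat) \<times> complex vec \<times> complex vec) set" where
  "param_space d = {(T, x, y). (\<forall>a. T a \<in> carrier_mat d d) \<and>
     x \<in> carrier_vec d \<and> y \<in> carrier_vec d \<and>
     mat_of_rows d [y] * letter_sum d T = mat_of_rows d [y]}"

(* The operation \<bullet> is bilinear (no conjugation), i.e. y \<bullet> z is y^T z. Points of the codomain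
   are functions on words n, represented by their extensional restriction. *)
definition model_map ::
  "nat \<Rightarrow> nat \<Rightarrow> ('a::finite \<Rightarrow> complex mat) \<times> complex vec \<times> complex vec \<Rightarrow> 'a list \<Rightarrow> complex" where
  "model_map n d = (\<lambda>(T, x, y). \<lambda>v\<in>words n. y \<bullet> (word_mat d T v *\<^sub>v x))"

end

theory Submission
  imports Defs
begin

text \<open>
  Write \<open>q\<close> for the family of marginals. A nonsingular maximal minor \<open>Q = [q (w\<^sub>j v\<^sub>i)]\<close> of a Hankel
  matrix with inverse \<open>H\<close> yields the skeleton decomposition
  \<open>q (t s) = \<Sum>\<^sub>i\<^sub>j q (w\<^sub>j s) H\<^sub>j\<^sub>i q (t v\<^sub>i)\<close>, because all bordered minors vanish; conversely such a
  decomposition bounds the rank.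

  If \<open>q (w v) = y\<^sup>T T\<^sub>v T\<^sub>w x\<close> in dimension \<open>d\<close>, then every linear relation between rows or columns that
  holds on words of length less than \<open>d\<close> holds on all words. Hence the skeleton decomposition of
  the matrix with both word lengths at most \<open>d - 1\<close> is valid for all larger Hankel matrices, which
  therefore have the same rank.

  Conversely, given the rank conditions, one minor \<open>Q\<close> with words of length at most \<open>d - 1\<close> serves
  both half-length Hankel matrices. The matrices \<open>T\<^sub>a = [q (w\<^sub>j a v\<^sub>i)] H\<close>, with \<open>x = [q (v\<^sub>i)]\<close> and
  \<open>y\<^sup>T = [q (w\<^sub>j)] H\<close>, padded by zeros to dimension \<open>d\<close>, then satisfy \<open>T\<^sub>t x = [q (t v\<^sub>i)]\<close> and
  \<open>y\<^sup>T T\<^sub>s = [q (w\<^sub>j s)] H\<close> for words up to half length, and the skeleton decomposition gives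
  \<open>y\<^sup>T T\<^sub>s T\<^sub>t x = q (t s)\<close>.
\<close>

section \<open>Minors, rank and skeleton decompositions\<close>

text \<open>Entrywise form of the kernel criterion: later arguments handle finite sums over
  \<open>{..<r}\<close> rather than vectors with carriers.\<close>

lemma det_eq_0_iff_kernel:
  fixes M :: "nat \<Rightarrow> nat \<Rightarrow> 'a::field"
  shows "det (mat r r (\<lambda>(i, j). M i j)) = 0 \<longleftrightarrow>
    (\<exists>x. (\<exists>j<r. x j \<noteq> 0) \<and> (\<forall>i<r. (\<Sum>j<r. M i j * x j) = 0))"
proof -
  let ?A = "mat r r (\<lambda>(i, j). M i j)"
  have row: "(?A *\<^sub>v v) $ i = (\<Sum>j<r. M i j * v $ j)" if "i < r" "v \<in> carrier_vec r" for i v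
    using that by (auto simp: scalar_prod_def atLeast0LessThan intro!: sum.cong)
  have "det ?A = 0 \<longleftrightarrow> (\<exists>v. v \<in> carrier_vec r \<and> v \<noteq> 0\<^sub>v r \<and> ?A *\<^sub>v v = 0\<^sub>v r)"
    by (rule det_0_iff_vec_prod_zero_field) simp
  also have "\<dots> \<longleftrightarrow> (\<exists>x. (\<exists>j<r. x j \<noteq> 0) \<and> (\<forall>i<r. (\<Sum>j<r. M i j * x j) = 0))"
  proof
    assume "\<exists>v. v \<in> carrier_vec r \<and> v \<noteq> 0\<^sub>v r \<and> ?A *\<^sub>v v = 0\<^sub>v r"
    then obtain v where v: "v \<in> carrier_vec r" "v \<noteq> 0\<^sub>v r" and z: "?A *\<^sub>v v = 0\<^sub>v r" by blast
    have "\<exists>j<r. v $ j \<noteq> 0"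
      using v by (metis carrier_vecD eq_vecI index_zero_vec)
    moreover have "(\<Sum>j<r. M i j * v $ j) = 0" if "i < r" for i
      using row[OF that v(1)] z that by simp
    ultimately show "\<exists>x. (\<exists>j<r. x j \<noteq> 0) \<and> (\<forall>i<r. (\<Sum>j<r. M i j * x j) = 0)"
      by (intro exI[of _ "\<lambda>j. v $ j"]) blast
  next
    assume "\<exists>x. (\<exists>j<r. x j \<noteq> 0) \<and> (\<forall>i<r. (\<Sum>j<r. M i j * x j) = 0)"
    then obtain x j where x: "\<forall>i<r. (\<Sum>j<r. M i j * x j) = 0" and j: "j < r" "x j \<noteq> 0" by blast
    have "vec r x \<noteq> 0\<^sub>v r" using j by (metis index_vec index_zero_vec(1))
    moreover have "?A *\<^sub>v vec r x = 0\<^sub>v r"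
    proof (rule eq_vecI)
      fix i assume "i < dim_vec (0\<^sub>v r :: 'a vec)"
      then have i: "i < r" by simp
      show "(?A *\<^sub>v vec r x) $ i = 0\<^sub>v r $ i"
        using row[OF i, of "vec r x"] x i by simp
    qed simp
    ultimately show "\<exists>v. v \<in> carrier_vec r \<and> v \<noteq> 0\<^sub>v r \<and> ?A *\<^sub>v v = 0\<^sub>v r"
      by (intro exI[of _ "vec r x"]) simp
  qed
  finally show ?thesis .
qed

lemma det_mat_transpose:
  "det (mat r r (\<lambda>(i, j). M j i)) = (det (mat r r (\<lambda>(i, j). M i j)) :: 'a::comm_ring_1)"
proof -
  have "mat r r (\<lambda>(i, j). M j i) = transpose_mat (mat r r (\<lambda>(i, j). M i j))"
    by (rule eq_matI) auto
  then show ?thesis by (simp add: det_transpose[of _ r])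
qed

text \<open>Padding \<open>C\<close> with zero rows to size \<open>s\<close> gives a square matrix
  whose row \<open>r\<close> is zero. The unit vector at \<open>r\<close> is in the kernel of the
  transpose, so both determinants vanish and a kernel vector exists.\<close>

lemma underdetermined_kernel:
  fixes C :: "nat \<Rightarrow> nat \<Rightarrow> 'a::field"
  assumes "r < s"
  obtains x where "\<exists>j<s. x j \<noteq> 0" and "\<And>i. i < r \<Longrightarrow> (\<Sum>j<s. C i j * x j) = 0"
proof -
  define M where "M i j = (if i < r then C i j else 0)" for i j
  have "(\<Sum>i<s. M i j * of_bool (i = r)) = 0" for j
    by (simp add: M_def)
  then have "det (mat s s (\<lambda>(i, j). M j i)) = 0"
    unfolding det_eq_0_iff_kernel using assms
    by (intro exI[of _ "\<lambda>i. of_bool (i = r)"]) auto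
  then have "det (mat s s (\<lambda>(i, j). M i j)) = 0"
    by (simp only: det_mat_transpose[of s M])
  then obtain x where x: "\<exists>j<s. x j \<noteq> 0" and "\<forall>i<s. (\<Sum>j<s. M i j * x j) = 0"
    unfolding det_eq_0_iff_kernel by blast
  then have "(\<Sum>j<s. C i j * x j) = 0" if "i < r" for i
    using that assms by (auto simp: M_def dest!: spec[of _ i])
  with x show ?thesis by (rule that)
qed

lemma inverse_entries:
  fixes M :: "nat \<Rightarrow> nat \<Rightarrow> 'a::field"
  assumes "det (mat r r (\<lambda>(i, j). M i j)) \<noteq> 0"
  obtains H where "\<And>i k. i < r \<Longrightarrow> k < r \<Longrightarrow> (\<Sum>j<r. H i j * M j k) = of_bool (i = k)"
proof -
  let ?A = "mat r r (\<lambda>(i, j). M i j)"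
  have A: "?A \<in> carrier_mat r r" by simp
  from det_non_zero_imp_unit[OF A assms] obtain B where
    B: "B \<in> carrier_mat r r" "B * ?A = 1\<^sub>m r"
    unfolding Units_def by (auto simp: ring_mat_simps)
  have "(\<Sum>j<r. B $$ (i, j) * M j k) = of_bool (i = k)" if "i < r" "k < r" for i k
  proof -
    have "(B * ?A) $$ (i, k) = (\<Sum>j<r. B $$ (i, j) * M j k)"
      using that B(1) by (auto simp: scalar_prod_def atLeast0LessThan intro!: sum.cong)
    moreover have "(B * ?A) $$ (i, k) = of_bool (i = k)"
      unfolding B(2) using that by simp
    ultimately show ?thesis by (rule trans[OF sym])
  qed
  then show ?thesis by (rule that[of "\<lambda>i j. B $$ (i, j)"])
qed

text \<open>Take a kernel vector \<open>x\<close> of the bordered matrix. The first \<open>r\<close>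
  rows and \<open>H\<close> express every \<open>x j\<close> through \<open>x r\<close>;
  substituting into the last row and cancelling \<open>x r\<close> gives the formula.\<close>

lemma bordered_minor_zero_imp_skeleton:
  fixes F :: "'b \<Rightarrow> 'c \<Rightarrow> 'a::field"
  assumes H: "\<And>i k. i < r \<Longrightarrow> k < r \<Longrightarrow> (\<Sum>j<r. H i j * F (v j) (w k)) = of_bool (i = k)"
    and det: "det (mat (Suc r) (Suc r) (\<lambda>(i, j). F ((v(r := s)) i) ((w(r := t)) j))) = 0"
  shows "F s t = (\<Sum>i<r. (\<Sum>j<r. F s (w j) * H j i) * F (v i) t)"
proof -
  from det obtain x where nz: "\<exists>j<Suc r. x j \<noteq> 0"
    and ker: "\<forall>i<Suc r. (\<Sum>j<Suc r. F ((v(r := s)) i) ((w(r := t)) j) * x j) = 0"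
    unfolding det_eq_0_iff_kernel by blast
  have rows: "(\<Sum>j<r. F (v i) (w j) * x j) = - (F (v i) t * x r)" if "i < r" for i
    using ker[rule_format, of i] that by (simp add: eq_neg_iff_add_eq_0)
  have last: "(\<Sum>j<r. F s (w j) * x j) = - (F s t * x r)"
    using ker[rule_format, of r] by (simp add: eq_neg_iff_add_eq_0)
  have x: "x j = - (\<Sum>i<r. H j i * F (v i) t) * x r" if j: "j < r" for j
  proof -
    have "x j = (\<Sum>k<r. of_bool (j = k) * x k)"
      using j by (simp add: of_bool_def if_distrib[of "\<lambda>z. z * _"] sum.delta' cong: if_cong)
    also have "\<dots> = (\<Sum>k<r. (\<Sum>i<r. H j i * F (v i) (w k)) * x k)"
      using j by (simp add: H)
    also have "\<dots> = (\<Sum>i<r. H j i * (\<Sum>k<r. F (v i) (w k) * x k))"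
      unfolding sum_distrib_left sum_distrib_right
      by (subst sum.swap) (simp add: mult.assoc)
    also have "\<dots> = (\<Sum>i<r. H j i * (- (F (v i) t * x r)))"
      by (simp add: rows)
    finally show ?thesis
      by (simp add: sum_negf sum_distrib_right mult.assoc)
  qed
  \<comment> \<open>All entries of \<open>x\<close> are multiples of \<open>x r\<close>, so
    \<open>x r = 0\<close> would make the whole kernel vector zero.\<close>
  have nzr: "x r \<noteq> 0"
  proof
    assume "x r = 0"
    then have "x j = 0" if "j < Suc r" for j
      using x that by (cases "j = r") (auto simp: less_Suc_eq)
    with nz show False by blast
  qed
  have "F s t * x r = - (\<Sum>j<r. F s (w j) * x j)"
    using last by simp
  also have "\<dots> = (\<Sum>j<r. F s (w j) * (\<Sum>i<r. H j i * F (v i) t)) * x r"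
    by (simp add: x sum_negf sum_distrib_right mult.assoc)
  also have "(\<Sum>j<r. F s (w j) * (\<Sum>i<r. H j i * F (v i) t)) =
      (\<Sum>i<r. (\<Sum>j<r. F s (w j) * H j i) * F (v i) t)"
    unfolding sum_distrib_left sum_distrib_right
    by (subst sum.swap) (simp add: mult.assoc)
  finally show ?thesis using nzr by simp
qed

text \<open>The columns selected by \<open>b\<close> are independent, because a relation between
  them, read in the rows selected by \<open>a\<close>, is a kernel vector of the nonsingular
  minor.\<close>

lemma minor_le_rank:
  fixes F :: "nat \<Rightarrow> nat \<Rightarrow> 'a::field"
  assumes a: "\<And>i. i < r \<Longrightarrow> a i < nr" and b: "\<And>j. j < r \<Longrightarrow> b j < nc"
    and det: "det (mat r r (\<lambda>(i, j). F (a i) (b j))) \<noteq> 0"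
  shows "r \<le> vec_space.rank nr (mat nr nc (\<lambda>(i, j). F i j))"
proof -
  interpret vec_space "TYPE('a)" nr .
  let ?A = "mat nr nc (\<lambda>(i, j). F i j)"
  define B where "B = mat nr r (\<lambda>(i, j). F i (b j))"
  have B: "B \<in> carrier_mat nr r" by (simp add: B_def)
  have nonker: "\<forall>j<r. x j = 0" if "\<And>i. i < r \<Longrightarrow> (\<Sum>j<r. F (a i) (b j) * x j) = 0" for x
    using det that unfolding det_eq_0_iff_kernel by blast
  \<comment> \<open>Independence is a property of the set of columns, so repetitions must be
    excluded first: two equal columns \<open>j\<close> and \<open>k\<close> would put the difference
    of two unit vectors in the kernel of the minor.\<close>
  have "inj_on (col B) {..<r}"
  proof (rule inj_onI, rule ccontr)
    fix j k assume jk: "j \<in> {..<r}" "k \<in> {..<r}" "col B j = col B k" "j \<noteq> k"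
    have eq: "F (a i) (b j) = F (a i) (b k)" if "i < r" for i
    proof -
      have "col B j $ a i = col B k $ a i" using jk(3) by simp
      then show ?thesis using jk(1,2) a[OF that] by (simp add: B_def)
    qed
    have "(\<Sum>l<r. F (a i) (b l) * (of_bool (l = j) - of_bool (l = k))) = 0" if "i < r" for i
      using jk(1,2) eq[OF that]
      by (simp add: algebra_simps sum_subtractf of_bool_def if_distrib[of "\<lambda>z. _ * z"] cong: if_cong)
    from nonker[OF this] jk show False by auto
  qed
  then have dist: "distinct (cols B)"
    using B by (simp add: cols_def distinct_map atLeast0LessThan)
  have indpt: "lin_indpt (set (cols B))"
  proof
    assume "lin_dep (set (cols B))"
    from lin_depE[OF B this dist] obtain x where
      x: "x \<in> carrier_vec r" "x \<noteq> 0\<^sub>v r" "B *\<^sub>v x = 0\<^sub>v nr" by blast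
    have "(\<Sum>j<r. F (a i) (b j) * x $ j) = 0" if "i < r" for i
    proof -
      have "(B *\<^sub>v x) $ a i = (\<Sum>j<r. F (a i) (b j) * x $ j)"
        using a[OF that] x(1) by (auto simp: B_def scalar_prod_def atLeast0LessThan intro!: sum.cong)
      then show ?thesis using x(3) a[OF that] by simp
    qed
    from nonker[OF this] have "x = 0\<^sub>v r"
      using x(1) by (intro eq_vecI) auto
    with x(2) show False by simp
  qed
  have "set (cols B) \<subseteq> set (cols ?A)"
  proof
    fix c assume "c \<in> set (cols B)"
    then obtain j where j: "j < r" "c = col B j" using B by (auto simp: cols_def)
    have "col B j = col ?A (b j)" using j(1) b[OF j(1)] by (intro eq_vecI) (auto simp: B_def)
    then show "c \<in> set (cols ?A)" using j b[OF j(1)] by (auto simp: cols_def)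
  qed
  from rank_ge_card_indpt[OF _ this indpt, of nc] have "card (set (cols B)) \<le> rank ?A" by simp
  then show ?thesis using distinct_card[OF dist] B by simp
qed

text \<open>Given more than \<open>r\<close> independent columns, \<open>h\<close> restricted to
  them has fewer rows than columns. A kernel vector of this restriction is then a nontrivial
  relation between the columns.\<close>

lemma rank_le_of_factorization:
  fixes F :: "nat \<Rightarrow> nat \<Rightarrow> 'a::field"
  assumes F: "\<And>i j. i < nr \<Longrightarrow> j < nc \<Longrightarrow> F i j = (\<Sum>l<r. g i l * h l j)"
  shows "vec_space.rank nr (mat nr nc (\<lambda>(i, j). F i j)) \<le> r"
proof (rule ccontr)
  interpret vec_space "TYPE('a)" nr .
  let ?A = "mat nr nc (\<lambda>(i, j). F i j)"
  assume "\<not> rank ?A \<le> r"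
  obtain S where S: "maximal S (\<lambda>T. T \<subseteq> set (cols ?A) \<and> lin_indpt T)"
    using maximal_exists_superset[of "set (cols ?A)" "\<lambda>T. T \<subseteq> set (cols ?A) \<and> lin_indpt T" "{}"]
    by (auto simp: finite_lin_indpt2)
  have "rank ?A = card S" by (rule rank_card_indpt[OF _ S, of nc]) simp
  with \<open>\<not> rank ?A \<le> r\<close> have card: "r < card S" by simp
  have sub: "S \<subseteq> set (cols ?A)" and indpt: "lin_indpt S" using S by (auto simp: maximal_def)
  obtain xs where xs: "set xs = S" "distinct xs"
    using finite_distinct_list[of S] finite_subset[OF sub] by auto
  let ?s = "length xs"
  have rs: "r < ?s" using card distinct_card[OF xs(2)] xs(1) by simp
  have "\<exists>k<nc. xs ! j = col ?A k" if "j < ?s" for j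
  proof -
    have "xs ! j \<in> set (cols ?A)" using sub xs(1) nth_mem[OF that] by blast
    then show ?thesis unfolding cols_def by auto
  qed
  then obtain k where k: "\<And>j. j < ?s \<Longrightarrow> k j < nc \<and> xs ! j = col ?A (k j)" by metis
  define B where "B = mat_of_cols nr xs"
  have B: "B \<in> carrier_mat nr ?s" by (simp add: B_def)
  have "set xs \<subseteq> carrier_vec nr" using sub xs(1) cols_dim[of ?A] by simp
  then have colsB: "cols B = xs" by (simp add: B_def)
  obtain x where x: "\<exists>j<?s. x j \<noteq> 0" "\<And>l. l < r \<Longrightarrow> (\<Sum>j<?s. h l (k j) * x j) = 0"
    using underdetermined_kernel[OF rs, of "\<lambda>l j. h l (k j)"] by blast
  have "B *\<^sub>v vec ?s x = 0\<^sub>v nr"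
  proof (rule eq_vecI)
    fix i assume "i < dim_vec (0\<^sub>v nr :: 'a vec)"
    then have i: "i < nr" by simp
    have "(B *\<^sub>v vec ?s x) $ i = (\<Sum>j<?s. F i (k j) * x j)"
      using i k by (simp add: B_def scalar_prod_def atLeast0LessThan mat_of_cols_index)
    also have "\<dots> = (\<Sum>j<?s. (\<Sum>l<r. g i l * h l (k j)) * x j)"
      using i k by (intro sum.cong) (auto simp: F)
    also have "\<dots> = (\<Sum>l<r. g i l * (\<Sum>j<?s. h l (k j) * x j))"
      unfolding sum_distrib_left sum_distrib_right by (subst sum.swap) (simp add: mult.assoc)
    also have "\<dots> = 0" by (simp add: x(2))
    finally show "(B *\<^sub>v vec ?s x) $ i = 0\<^sub>v nr $ i" using i by simp
  qed (simp add: B_def)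
  moreover have "vec ?s x \<noteq> 0\<^sub>v ?s" using x(1) by (metis index_vec index_zero_vec(1))
  ultimately have "lin_dep (set (cols B))"
    by (intro lin_depI[OF B]) (auto simp: colsB xs(2))
  with indpt colsB xs(1) show False by simp
qed

section \<open>Hankel matrices\<close>

lemma minor_le_hankel_rank:
  assumes v: "\<And>i. i < r \<Longrightarrow> v i \<in> words_le k" and w: "\<And>j. j < r \<Longrightarrow> w j \<in> words_le m"
    and det: "det (mat r r (\<lambda>(i, j). q (w j @ v i))) \<noteq> 0"
  shows "r \<le> mat_rank (hankel q k m)"
proof -
  define vs where "vs = enumeration (words_le k :: 'a list set)"
  define ws where "ws = enumeration (words_le m :: 'a list set)"
  have vs: "set vs = words_le k" and ws: "set ws = words_le m"
    unfolding vs_def ws_def by (rule enumeration(2)[OF finite_words_le])+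
  have "\<exists>a<length vs. vs ! a = v i" if "i < r" for i
    using v[OF that] vs by (metis in_set_conv_nth)
  then obtain a where a: "\<And>i. i < r \<Longrightarrow> a i < length vs \<and> vs ! a i = v i" by metis
  have "\<exists>b<length ws. ws ! b = w j" if "j < r" for j
    using w[OF that] ws by (metis in_set_conv_nth)
  then obtain b where b: "\<And>j. j < r \<Longrightarrow> b j < length ws \<and> ws ! b j = w j" by metis
  have "mat r r (\<lambda>(i, j). q (ws ! b j @ vs ! a i)) = mat r r (\<lambda>(i, j). q (w j @ v i))"
    using a b by (intro eq_matI) auto
  then have "r \<le> vec_space.rank (length vs) (mat (length vs) (length ws) (\<lambda>(i, j). q (ws ! j @ vs ! i)))"
    using a b det by (intro minor_le_rank[of r a _ b]) auto
  then show ?thesis by (simp add: mat_rank_def hankel_def vs_def ws_def Let_def)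
qed

lemma hankel_rank_le_of_factorization:
  assumes "\<And>v w. v \<in> words_le k \<Longrightarrow> w \<in> words_le m \<Longrightarrow> q (w @ v) = (\<Sum>l<r. g v l * h l w)"
  shows "mat_rank (hankel q k m) \<le> r"
proof -
  define vs where "vs = enumeration (words_le k :: 'a list set)"
  define ws where "ws = enumeration (words_le m :: 'a list set)"
  have vs: "set vs = words_le k" and ws: "set ws = words_le m"
    unfolding vs_def ws_def by (rule enumeration(2)[OF finite_words_le])+
  have "vs ! i \<in> words_le k" if "i < length vs" for i
    using nth_mem[OF that] vs by simp
  moreover have "ws ! j \<in> words_le m" if "j < length ws" for j
    using nth_mem[OF that] ws by simp
  ultimately have "vec_space.rank (length vs) (mat (length vs) (length ws) (\<lambda>(i, j). q (ws ! j @ vs ! i))) \<le> r"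
    by (intro rank_le_of_factorization[where g = "\<lambda>i. g (vs ! i)" and h = "\<lambda>l j. h l (ws ! j)"])
      (simp add: assms)
  then show ?thesis by (simp add: mat_rank_def hankel_def vs_def ws_def Let_def)
qed

text \<open>A nonsingular minor of maximal size \<open>r\<close> among sizes at most
  \<open>s\<close> has only singular borderings, and the resulting skeleton decomposition factors
  the matrix through dimension \<open>r\<close>.\<close>

lemma hankel_rank_le_of_minors:
  assumes "\<And>v w. (\<And>i. i < Suc s \<Longrightarrow> v i \<in> words_le k) \<Longrightarrow> (\<And>j. j < Suc s \<Longrightarrow> w j \<in> words_le m) \<Longrightarrow>
    det (mat (Suc s) (Suc s) (\<lambda>(i, j). q (w j @ v i))) = 0"
  shows "mat_rank (hankel q k m) \<le> s"
proof -
  define P where "P r \<longleftrightarrow> (\<exists>v w. (\<forall>i<r. v i \<in> words_le k) \<and> (\<forall>j<r. w j \<in> words_le m) \<and>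
    det (mat r r (\<lambda>(i, j). q (w j @ v i))) \<noteq> 0)" for r
  define r where "r = (GREATEST r. r \<le> s \<and> P r)"
  \<comment> \<open>The empty minor has determinant 1, so the maximum is taken over a nonempty
    set.\<close>
  have "det (mat 0 0 f) \<noteq> (0::real)" for f by simp
  then have P0: "0 \<le> s \<and> P 0" unfolding P_def by blast
  have r: "r \<le> s \<and> P r"
    unfolding r_def using P0 by (rule GreatestI_nat[where b = s]) simp
  \<comment> \<open>For \<open>r = s\<close> this is the hypothesis on minors; for
    \<open>r < s\<close> it is the maximality of \<open>r\<close>.\<close>
  have nP: "\<not> P (Suc r)"
  proof
    assume P: "P (Suc r)"
    have "\<not> P (Suc s)" using assms unfolding P_def by blast
    with P r have "Suc r \<le> s \<and> P (Suc r)" by (metis le_neq_implies_less Suc_leI)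
    then have "Suc r \<le> r" unfolding r_def by (rule Greatest_le_nat[where b = s]) simp
    then show False by simp
  qed
  from r obtain v w where v: "\<forall>i<r. v i \<in> words_le k" and w: "\<forall>j<r. w j \<in> words_le m"
    and det: "det (mat r r (\<lambda>(i, j). q (w j @ v i))) \<noteq> 0" unfolding P_def by blast
  from inverse_entries[OF det] obtain H where
    H: "\<And>i k. i < r \<Longrightarrow> k < r \<Longrightarrow> (\<Sum>j<r. H i j * q (w k @ v j)) = of_bool (i = k)" by blast
  have "q (t @ s) = (\<Sum>i<r. (\<Sum>j<r. q (w j @ s) * H j i) * q (t @ v i))"
    if "s \<in> words_le k" "t \<in> words_le m" for s t
  proof (rule bordered_minor_zero_imp_skeleton[where F = "\<lambda>s t. q (t @ s)", OF H])
    have "(v(r := s)) i \<in> words_le k" "(w(r := t)) i \<in> words_le m" if "i < Suc r" for i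
      using v w that \<open>s \<in> words_le k\<close> \<open>t \<in> words_le m\<close> by (auto simp: less_Suc_eq)
    then show "det (mat (Suc r) (Suc r) (\<lambda>(i, j). q ((w(r := t)) j @ (v(r := s)) i))) = 0"
      using nP unfolding P_def by blast
  qed
  then have "mat_rank (hankel q k m) \<le> r"
    by (rule hankel_rank_le_of_factorization)
  with r show ?thesis by simp
qed

text \<open>If all minors of the size of a positive rank vanished,
  \<open>hankel_rank_le_of_minors\<close> would give a smaller rank. For rank zero the empty minor
  serves.\<close>

lemma hankel_rank_minor:
  obtains v w where "\<And>i. i < mat_rank (hankel q k m) \<Longrightarrow> v i \<in> words_le k"
    and "\<And>j. j < mat_rank (hankel q k m) \<Longrightarrow> w j \<in> words_le m"
    and "det (mat (mat_rank (hankel q k m)) (mat_rank (hankel q k m)) (\<lambda>(i, j). q (w j @ v i))) \<noteq> 0"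
proof (cases "mat_rank (hankel q k m)")
  case 0
  show ?thesis by (rule that) (simp_all add: 0)
next
  case (Suc s)
  then have "\<not> mat_rank (hankel q k m) \<le> s" by simp
  then show ?thesis
    using hankel_rank_le_of_minors[of s k m q] that unfolding Suc by blast
qed

text \<open>Each bordered minor has size \<open>r + 1\<close>, which exceeds the rank, and hence
  vanishes.\<close>

lemma hankel_skeleton:
  assumes v: "\<And>i. i < r \<Longrightarrow> v i \<in> words_le k" and w: "\<And>j. j < r \<Longrightarrow> w j \<in> words_le m"
    and rank: "mat_rank (hankel q k m) \<le> r"
    and H: "\<And>i k. i < r \<Longrightarrow> k < r \<Longrightarrow> (\<Sum>j<r. H i j * q (w k @ v j)) = of_bool (i = k)"
    and s: "s \<in> words_le k" and t: "t \<in> words_le m"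
  shows "q (t @ s) = (\<Sum>i<r. (\<Sum>j<r. q (w j @ s) * H j i) * q (t @ v i))"
proof (rule bordered_minor_zero_imp_skeleton[where F = "\<lambda>s t. q (t @ s)", OF H])
  have "(v(r := s)) i \<in> words_le k" "(w(r := t)) i \<in> words_le m" if "i < Suc r" for i
    using v w that s t by (auto simp: less_Suc_eq)
  with minor_le_hankel_rank[of "Suc r" "v(r := s)" k "w(r := t)" m q] rank
  show "det (mat (Suc r) (Suc r) (\<lambda>(i, j). q ((w(r := t)) j @ (v(r := s)) i))) = 0"
    by fastforce
qed

lemma minors_vanish_iff_rank_le:
  "minors_vanish q d \<longleftrightarrow> mat_rank (hankel q (d - 1) (d - 1)) \<le> d"
proof
  assume *: "minors_vanish q d"
  show "mat_rank (hankel q (d - 1) (d - 1)) \<le> d"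
  proof (rule hankel_rank_le_of_minors)
    fix v w :: "nat \<Rightarrow> 'a list"
    assume "\<And>i. i < Suc d \<Longrightarrow> v i \<in> words_le (d - 1)" "\<And>j. j < Suc d \<Longrightarrow> w j \<in> words_le (d - 1)"
    then have "\<forall>i\<in>{1..d + 1}. v (i - 1) \<in> words_le (d - 1) \<and> w (i - 1) \<in> words_le (d - 1)" by auto
    \<comment> \<open>\<open>minors_vanish\<close> numbers words from 1, the minors here from 0; the
      shift by one reconciles them.\<close>
    with *[unfolded minors_vanish_def, rule_format, of "\<lambda>i. v (i - 1)" "\<lambda>i. w (i - 1)"]
    show "det (mat (Suc d) (Suc d) (\<lambda>(i, j). q (w j @ v i))) = 0" by simp
  qed
next
  assume *: "mat_rank (hankel q (d - 1) (d - 1)) \<le> d"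
  show "minors_vanish q d"
    unfolding minors_vanish_def
  proof (intro allI impI)
    fix v w :: "nat \<Rightarrow> 'a list"
    assume vw: "\<forall>i\<in>{1..d + 1}. v i \<in> words_le (d - 1) \<and> w i \<in> words_le (d - 1)"
    show "det (mat (d + 1) (d + 1) (\<lambda>(i, j). q (w (j + 1) @ v (i + 1)))) = 0"
    proof (rule ccontr)
      assume "det (mat (d + 1) (d + 1) (\<lambda>(i, j). q (w (j + 1) @ v (i + 1)))) \<noteq> 0"
      with vw have "d + 1 \<le> mat_rank (hankel q (d - 1) (d - 1))"
        by (intro minor_le_hankel_rank[of _ "\<lambda>i. v (i + 1)" _ "\<lambda>j. w (j + 1)"]) auto
      with * show False by simp
    qed
  qed
qed

section \<open>Extension of linear relations to longer words\<close>

text \<open>The columns \<open>C\<close> at the \<open>d + 1\<close> shortest prefixes of a long word \<open>w\<close> are linearly dependent.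
  Solving such a dependence for the longest prefix involved rewrites \<open>f (w @ v)\<close> as a combination,
  uniform in \<open>v\<close>, of values of \<open>f\<close> at shorter words in place of \<open>w\<close>.\<close>
lemma linear_relation_extends_right:
  fixes f :: "'a list \<Rightarrow> 'b::field"
  assumes fac: "\<And>v w. f (w @ v) = (\<Sum>k<d. R k v * C k w)"
    and short: "\<And>w. length w < d \<Longrightarrow> (\<Sum>i\<in>I. l i * f (w @ v i)) = 0"
  shows "(\<Sum>i\<in>I. l i * f (w @ v i)) = 0"
proof (induction w rule: length_induct)
  case (1 w)
  show ?case
  proof (cases "length w < d")
    case True
    then show ?thesis by (rule short)
  next
    case False
    obtain c where c: "\<exists>j<Suc d. c j \<noteq> 0"
      and ker: "\<And>k. k < d \<Longrightarrow> (\<Sum>j<Suc d. C k (take j w) * c j) = 0"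
      using underdetermined_kernel[of d "Suc d" "\<lambda>k j. C k (take j w)"] by blast
    \<comment> \<open>\<open>J\<close> is the length of the longest prefix with nonzero coefficient,
      the one to be solved for.\<close>
    define J where "J = (GREATEST j. j < Suc d \<and> c j \<noteq> 0)"
    from c obtain j where "j < Suc d \<and> c j \<noteq> 0" by blast
    then have J: "J < Suc d \<and> c J \<noteq> 0"
      unfolding J_def by (rule GreatestI_nat[where b = d]) simp
    have above: "c j = 0" if "J < j" "j < Suc d" for j
    proof (rule ccontr)
      assume "c j \<noteq> 0"
      with that(2) have "j < Suc d \<and> c j \<noteq> 0" by simp
      then have "j \<le> J" unfolding J_def by (rule Greatest_le_nat[where b = d]) simp
      with that(1) show False by simp
    qed
    define L where "L u = (\<Sum>i\<in>I. l i * f (u @ v i))" for u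
    \<comment> \<open>Appending this tail to the prefix of length \<open>J\<close> restores
      \<open>w\<close>, while appending it to a shorter prefix gives a word shorter than
      \<open>w\<close>, to which the induction hypothesis applies.\<close>
    define s where "s = drop J w"
    have rel: "(\<Sum>j<Suc d. c j * f (take j w @ u)) = 0" for u
    proof -
      have "(\<Sum>j<Suc d. c j * f (take j w @ u)) = (\<Sum>j<Suc d. \<Sum>k<d. R k u * (C k (take j w) * c j))"
        unfolding fac sum_distrib_left by (simp only: ac_simps)
      also have "\<dots> = (\<Sum>k<d. R k u * (\<Sum>j<Suc d. C k (take j w) * c j))"
        unfolding sum_distrib_left by (rule sum.swap)
      also have "\<dots> = 0" by (intro sum.neutral ballI) (simp only: ker lessThan_iff mult_zero_right)
      finally show ?thesis .
    qed
    have "(\<Sum>j<Suc d. c j * L (take j w @ s)) = (\<Sum>i\<in>I. l i * (\<Sum>j<Suc d. c j * f (take j w @ s @ v i)))"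
      unfolding L_def sum_distrib_left by (subst sum.swap) (simp only: ac_simps append_assoc)
    also have "\<dots> = 0" by (simp only: rel mult_zero_right sum.neutral_const)
    finally have "0 = (\<Sum>j<Suc d. c j * L (take j w @ s))" ..
    also have "\<dots> = (\<Sum>j<Suc d. if j = J then c J * L w else 0)"
    proof (rule sum.cong[OF refl])
      fix j assume j: "j \<in> {..<Suc d}"
      consider "j < J" | "j = J" | "J < j" by linarith
      then show "c j * L (take j w @ s) = (if j = J then c J * L w else 0)"
      proof cases
        case 1
        then have "length (take j w @ s) < length w"
          using False J unfolding s_def length_append length_take length_drop by linarith
        then have "L (take j w @ s) = 0" using "1.IH" unfolding L_def by blast
        with 1 show ?thesis by simp
      next
        case 2
        then show ?thesis by (simp add: s_def)
      next
        case 3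
        then show ?thesis using above[of j] j by simp
      qed
    qed
    also have "\<dots> = c J * L w" using J by simp
    finally show ?thesis using J by (simp add: L_def)
  qed
qed

text \<open>Reversing all words exchanges prefixes with suffixes and the roles of \<open>R\<close>
  and \<open>C\<close>.\<close>

lemma linear_relation_extends_left:
  fixes f :: "'a list \<Rightarrow> 'b::field"
  assumes fac: "\<And>v w. f (w @ v) = (\<Sum>k<d. R k v * C k w)"
    and short: "\<And>v. length v < d \<Longrightarrow> (\<Sum>i\<in>I. l i * f (w i @ v)) = 0"
  shows "(\<Sum>i\<in>I. l i * f (w i @ v)) = 0"
proof -
  have "(\<Sum>i\<in>I. l i * f (rev (rev v @ rev (w i)))) = 0"
  proof (rule linear_relation_extends_right)
    show "f (rev (u @ v)) = (\<Sum>k<d. C k (rev v) * R k (rev u))" for u v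
      by (simp add: fac mult.commute)
    show "(\<Sum>i\<in>I. l i * f (rev (u @ rev (w i)))) = 0" if "length u < d" for u
      using short[of "rev u"] that by simp
  qed
  then show ?thesis by simp
qed

text \<open>The decomposition is a linear relation with \<open>r + 1\<close> terms. It is extended
  first in \<open>t\<close> for short \<open>s\<close>, then in \<open>s\<close> for arbitrary
  \<open>t\<close>.\<close>

lemma skeleton_extends:
  fixes f :: "'a list \<Rightarrow> 'b::field" and r :: nat
  assumes fac: "\<And>v w. f (w @ v) = (\<Sum>k<d. R k v * C k w)"
    and short: "\<And>s t. length s < d \<Longrightarrow> length t < d \<Longrightarrow>
      f (t @ s) = (\<Sum>i<r. (\<Sum>j<r. f (w j @ s) * H j i) * f (t @ v i))"
  shows "f (t @ s) = (\<Sum>i<r. (\<Sum>j<r. f (w j @ s) * H j i) * f (t @ v i))"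
proof -
  have step: "f (t @ s) = (\<Sum>i<r. (\<Sum>j<r. f (w j @ s) * H j i) * f (t @ v i))"
    if s: "length s < d" for s t
  proof -
    \<comment> \<open>The word \<open>s\<close> itself enters as the term with index
      \<open>r\<close> and coefficient 1. The coefficients do not involve \<open>t\<close>, so the
      relation is uniform in \<open>t\<close>.\<close>
    define l where "l i = (if i < r then - (\<Sum>j<r. f (w j @ s) * H j i) else 1)" for i
    have eq: "(\<Sum>i<Suc r. l i * f (t @ (v(r := s)) i)) =
        f (t @ s) - (\<Sum>i<r. (\<Sum>j<r. f (w j @ s) * H j i) * f (t @ v i))" for t
      by (simp add: l_def sum_negf)
    have "(\<Sum>i<Suc r. l i * f (t @ (v(r := s)) i)) = 0" if "length t < d" for t
      unfolding eq using short[OF s that] by simp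
    from linear_relation_extends_right[where f = f and R = R and C = C and v = "v(r := s)" and w = t, OF fac this] show ?thesis
      unfolding eq by (simp only: right_minus_eq)
  qed
  \<comment> \<open>The same sum is regrouped so that the coefficients depend on \<open>t\<close>
    alone and the relation is uniform in \<open>s\<close>.\<close>
  define l where "l j = (if j < r then - (\<Sum>i<r. H j i * f (t @ v i)) else 1)" for j
  have eq: "(\<Sum>j<Suc r. l j * f ((w(r := t)) j @ s)) =
      f (t @ s) - (\<Sum>i<r. (\<Sum>j<r. f (w j @ s) * H j i) * f (t @ v i))" for s
  proof -
    have "(\<Sum>j<r. (\<Sum>i<r. H j i * f (t @ v i)) * f (w j @ s)) =
        (\<Sum>i<r. (\<Sum>j<r. f (w j @ s) * H j i) * f (t @ v i))"
      unfolding sum_distrib_right by (subst sum.swap) (simp only: ac_simps)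
    then show ?thesis by (simp add: l_def sum_negf)
  qed
  have "(\<Sum>j<Suc r. l j * f ((w(r := t)) j @ s)) = 0" if "length s < d" for s
    unfolding eq using step[OF that, of t] by simp
  from linear_relation_extends_left[where f = f and R = R and C = C and w = "w(r := t)" and v = s, OF fac this] show ?thesis
    unfolding eq by (simp only: right_minus_eq)
qed

section \<open>Realizations by parameter tuples\<close>

lemma word_mat_Nil [simp]: "word_mat d T [] = 1\<^sub>m d"
  by (simp add: word_mat_def)

lemma word_mat_snoc: "word_mat d T (w @ [a]) = T a * word_mat d T w"
  by (simp add: word_mat_def)

lemma word_mat_carrier:
  assumes "\<And>a. T a \<in> carrier_mat d d"
  shows "word_mat d T w \<in> carrier_mat d d"
proof (induction w rule: rev_induct)
  case (snoc a w)
  then show ?case using assms[of a] by (simp add: word_mat_snoc)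
qed simp

lemma word_mat_append:
  assumes T: "\<And>a. T a \<in> carrier_mat d d"
  shows "word_mat d T (w @ v) = word_mat d T v * word_mat d T w"
proof (induction v rule: rev_induct)
  case Nil
  then show ?case using left_mult_one_mat[OF word_mat_carrier[of T, OF T]] by simp
next
  case (snoc a v)
  have "word_mat d T (w @ v @ [a]) = T a * (word_mat d T v * word_mat d T w)"
    using word_mat_snoc[of d T "w @ v" a] snoc by simp
  also have "\<dots> = T a * word_mat d T v * word_mat d T w"
    using T word_mat_carrier[of T, OF T] by (simp add: assoc_mult_mat[of _ d d _ d _ d])
  finally show ?case by (simp add: word_mat_snoc)
qed

lemma scalar_prod_mult_mat_vec:
  fixes y z :: "'b::comm_ring_1 vec"
  assumes "A \<in> carrier_mat d d" "y \<in> carrier_vec d" "z \<in> carrier_vec d"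
  shows "y \<bullet> (A *\<^sub>v z) = (\<Sum>k<d. (\<Sum>i<d. y $ i * A $$ (i, k)) * z $ k)"
proof -
  have "(A *\<^sub>v z) $ i = (\<Sum>k<d. A $$ (i, k) * z $ k)" if "i < d" for i
    using assms that by (auto simp: scalar_prod_def atLeast0LessThan intro!: sum.cong)
  then have "y \<bullet> (A *\<^sub>v z) = (\<Sum>i<d. y $ i * (\<Sum>k<d. A $$ (i, k) * z $ k))"
    using assms by (simp add: scalar_prod_def atLeast0LessThan)
  also have "\<dots> = (\<Sum>k<d. (\<Sum>i<d. y $ i * A $$ (i, k)) * z $ k)"
    unfolding sum_distrib_left sum_distrib_right by (subst sum.swap) (simp only: mult.assoc)
  finally show ?thesis .
qed

lemma row_invariant_iff:
  assumes "y \<in> carrier_vec d"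
  shows "mat_of_rows d [y] * letter_sum d T = mat_of_rows d [y] \<longleftrightarrow>
    (\<forall>j<d. (\<Sum>a\<in>UNIV. \<Sum>i<d. y $ i * T a $$ (i, j)) = y $ j)"
proof -
  have eq: "(mat_of_rows d [y] * letter_sum d T) $$ (0, j) =
      (\<Sum>a\<in>UNIV. \<Sum>i<d. y $ i * T a $$ (i, j))" if "j < d" for j
  proof -
    have "(mat_of_rows d [y] * letter_sum d T) $$ (0, j) =
        (\<Sum>i<d. y $ i * (\<Sum>a\<in>UNIV. T a $$ (i, j)))"
      using that assms
      by (simp add: letter_sum_def scalar_prod_def atLeast0LessThan mat_of_rows_def)
    also have "\<dots> = (\<Sum>a\<in>UNIV. \<Sum>i<d. y $ i * T a $$ (i, j))"
      unfolding sum_distrib_left by (rule sum.swap)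
    finally show ?thesis .
  qed
  have row: "mat_of_rows d [y] $$ (0, j) = y $ j" if "j < d" for j
    using that by (simp add: mat_of_rows_def)
  show ?thesis
  proof
    assume *: "mat_of_rows d [y] * letter_sum d T = mat_of_rows d [y]"
    show "\<forall>j<d. (\<Sum>a\<in>UNIV. \<Sum>i<d. y $ i * T a $$ (i, j)) = y $ j"
    proof (intro allI impI)
      fix j assume j: "j < d"
      show "(\<Sum>a\<in>UNIV. \<Sum>i<d. y $ i * T a $$ (i, j)) = y $ j"
        unfolding eq[OF j, symmetric] row[OF j, symmetric] by (simp only: *)
    qed
  next
    assume *: "\<forall>j<d. (\<Sum>a\<in>UNIV. \<Sum>i<d. y $ i * T a $$ (i, j)) = y $ j"
    show "mat_of_rows d [y] * letter_sum d T = mat_of_rows d [y]"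
    proof (rule eq_matI)
      fix i j assume "i < dim_row (mat_of_rows d [y])" "j < dim_col (mat_of_rows d [y])"
      then have i: "i = 0" and j: "j < d" by simp_all
      show "(mat_of_rows d [y] * letter_sum d T) $$ (i, j) = mat_of_rows d [y] $$ (i, j)"
        unfolding i eq[OF j] row[OF j] using * j by blast
    qed (simp_all add: letter_sum_def)
  qed
qed

section \<open>Marginals and their values under the model\<close>

lemma marginal_full: "length u = n \<Longrightarrow> marginal n p u = p u"
  by (simp add: marginal_def words_def)

text \<open>The suffixes summed over are split by their first letter.\<close>

lemma marginal_snoc:
  assumes "length u < n"
  shows "marginal n p u = (\<Sum>a\<in>UNIV. marginal n p (u @ [a]))"
proof -
  obtain k where k: "n - length u = Suc k" using assms by (metis Suc_diff_Suc)
  then have k': "n - Suc (length u) = k" by simp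
  have "bij_betw (\<lambda>(a, v). a # v) (UNIV \<times> words k) (words (Suc k) :: 'a list set)"
    by (rule bij_betwI[where g = "\<lambda>v. (hd v, tl v)"]) (auto simp: words_def length_Suc_conv)
  then have "(\<Sum>v\<in>words (Suc k). p (u @ v)) = (\<Sum>(a, v)\<in>UNIV \<times> words k. p (u @ a # v))"
    by (rule sum.reindex_bij_betw[symmetric, THEN trans]) (simp add: case_prod_unfold)
  also have "\<dots> = (\<Sum>a\<in>UNIV. \<Sum>v\<in>words k. p (u @ a # v))"
    by (rule sum.cartesian_product[symmetric])
  finally show ?thesis by (simp add: marginal_def k k')
qed

text \<open>Induction from full words down to shorter ones: summing over the last letter inserts the
  sum of all \<open>T a\<close> next to \<open>y\<close>, where the invariance of \<open>y\<close>
  absorbs it.\<close>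

lemma model_marginal:
  assumes par: "(T, x, y) \<in> param_space d"
    and top: "\<And>v. v \<in> words n \<Longrightarrow> complex_of_real (p v) = y \<bullet> (word_mat d T v *\<^sub>v x)"
    and "length u \<le> n"
  shows "complex_of_real (marginal n p u) = y \<bullet> (word_mat d T u *\<^sub>v x)"
  using \<open>length u \<le> n\<close>
proof (induction "n - length u" arbitrary: u)
  case 0
  then show ?case using top[of u] by (simp add: marginal_full words_def)
next
  case (Suc k)
  have T: "\<And>a. T a \<in> carrier_mat d d" and x: "x \<in> carrier_vec d" and y: "y \<in> carrier_vec d"
    and inv: "mat_of_rows d [y] * letter_sum d T = mat_of_rows d [y]"
    using par by (auto simp: param_space_def)
  have W: "word_mat d T u \<in> carrier_mat d d" by (rule word_mat_carrier[of T, OF T])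
  let ?z = "word_mat d T u *\<^sub>v x"
  have z: "?z \<in> carrier_vec d" using W x by (rule mult_mat_vec_carrier)
  have "complex_of_real (marginal n p u) = (\<Sum>a\<in>UNIV. complex_of_real (marginal n p (u @ [a])))"
    using Suc.hyps(2) by (subst marginal_snoc) simp_all
  also have "\<dots> = (\<Sum>a\<in>UNIV. y \<bullet> (T a *\<^sub>v ?z))"
  proof (rule sum.cong[OF refl])
    fix a :: 'a
    have "complex_of_real (marginal n p (u @ [a])) = y \<bullet> (word_mat d T (u @ [a]) *\<^sub>v x)"
      using Suc.hyps by auto
    then show "complex_of_real (marginal n p (u @ [a])) = y \<bullet> (T a *\<^sub>v ?z)"
      using T[of a] W x by (simp add: word_mat_snoc assoc_mult_mat_vec[of _ d d _ d])
  qed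
  also have "\<dots> = (\<Sum>a\<in>UNIV. \<Sum>k<d. (\<Sum>i<d. y $ i * T a $$ (i, k)) * ?z $ k)"
    by (intro sum.cong refl scalar_prod_mult_mat_vec T y z)
  also have "\<dots> = (\<Sum>k<d. (\<Sum>a\<in>UNIV. \<Sum>i<d. y $ i * T a $$ (i, k)) * ?z $ k)"
    unfolding sum_distrib_right[where r = "?z $ _"] by (rule sum.swap)
  also have "\<dots> = (\<Sum>k<d. y $ k * ?z $ k)"
    using inv unfolding row_invariant_iff[OF y] by (intro sum.cong) auto
  also have "\<dots> = y \<bullet> ?z"
    using y z W by (simp add: scalar_prod_def atLeast0LessThan)
  finally show ?case .
qed

section \<open>Necessity of the rank conditions\<close>

text \<open>The complex matrix factors through dimension \<open>d\<close>, so its minors of size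
  \<open>d + 1\<close> are singular; the determinant commutes with the embedding of the
  reals.\<close>

lemma minors_vanish_of_realization:
  assumes fac: "\<And>v w. f (w @ v) = (\<Sum>k<d. R k v * C k w :: complex)"
    and q: "\<And>u. length u \<le> n \<Longrightarrow> complex_of_real (q u) = f u"
    and n: "2 * d - 1 \<le> n"
  shows "minors_vanish q d"
  unfolding minors_vanish_iff_rank_le
proof (rule hankel_rank_le_of_minors)
  fix v w :: "nat \<Rightarrow> 'a list"
  assume v: "\<And>i. i < Suc d \<Longrightarrow> v i \<in> words_le (d - 1)"
    and w: "\<And>j. j < Suc d \<Longrightarrow> w j \<in> words_le (d - 1)"
  let ?M = "mat (Suc d) (Suc d) (\<lambda>(i, j). q (w j @ v i))"
  have "length (w j @ v i) \<le> n" if "i < Suc d" "j < Suc d" for i j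
    using v[OF that(1)] w[OF that(2)] n by (simp add: words_le_def)
  then have M: "map_mat complex_of_real ?M = mat (Suc d) (Suc d) (\<lambda>(i, j). f (w j @ v i))"
    using q by (intro eq_matI) auto
  obtain c where c: "\<exists>j<Suc d. c j \<noteq> 0" "\<And>k. k < d \<Longrightarrow> (\<Sum>j<Suc d. C k (w j) * c j) = 0"
    using underdetermined_kernel[of d "Suc d" "\<lambda>k j. C k (w j)"] by blast
  have "(\<Sum>j<Suc d. f (w j @ v i) * c j) = 0" for i
  proof -
    have "(\<Sum>j<Suc d. f (w j @ v i) * c j) = (\<Sum>j<Suc d. \<Sum>k<d. R k (v i) * (C k (w j) * c j))"
      unfolding fac sum_distrib_right by (simp only: mult.assoc)
    also have "\<dots> = (\<Sum>k<d. R k (v i) * (\<Sum>j<Suc d. C k (w j) * c j))"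
      unfolding sum_distrib_left by (rule sum.swap)
    also have "\<dots> = 0" by (intro sum.neutral ballI) (simp only: c(2) lessThan_iff mult_zero_right)
    finally show ?thesis .
  qed
  with c(1) have "det (mat (Suc d) (Suc d) (\<lambda>(i, j). f (w j @ v i))) = 0"
    unfolding det_eq_0_iff_kernel by blast
  then have "complex_of_real (det ?M) = 0"
    unfolding M[symmetric] by (simp only: of_real_hom.hom_det)
  then show "det ?M = 0" by simp
qed

text \<open>Short words are admissible in the larger matrix, which gives one inequality. For the
  other, the skeleton decomposition of the small matrix extends to longer words and factors the
  larger one.\<close>

lemma hankel_rank_of_realization:
  assumes fac: "\<And>v w. f (w @ v) = (\<Sum>k<d. R k v * C k w :: complex)"
    and q: "\<And>u. length u \<le> n \<Longrightarrow> complex_of_real (q u) = f u"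
    and d: "d \<ge> 1" and k: "d - 1 \<le> k" and m: "d - 1 \<le> m" and km: "k + m \<le> n"
  shows "mat_rank (hankel q k m) = mat_rank (hankel q (d - 1) (d - 1))"
proof (rule antisym)
  define r where "r = mat_rank (hankel q (d - 1) (d - 1))"
  obtain v w where v: "\<And>i. i < r \<Longrightarrow> v i \<in> words_le (d - 1)"
    and w: "\<And>j. j < r \<Longrightarrow> w j \<in> words_le (d - 1)"
    and det: "det (mat r r (\<lambda>(i, j). q (w j @ v i))) \<noteq> 0"
    unfolding r_def using hankel_rank_minor[of q "d - 1" "d - 1"] by blast
  have "v i \<in> words_le k" if "i < r" for i using v[OF that] k by (simp add: words_le_def)
  moreover have "w j \<in> words_le m" if "j < r" for j using w[OF that] m by (simp add: words_le_def)
  ultimately show "mat_rank (hankel q (d - 1) (d - 1)) \<le> mat_rank (hankel q k m)"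
    unfolding r_def[symmetric] using det by (rule minor_le_hankel_rank)
  from inverse_entries[OF det] obtain H where
    H: "\<And>i k. i < r \<Longrightarrow> k < r \<Longrightarrow> (\<Sum>j<r. H i j * q (w k @ v j)) = of_bool (i = k)" by blast
  define H' where "H' i j = complex_of_real (H i j)" for i j
  \<comment> \<open>The extension lemma needs a factorization on all words, which \<open>f\<close>
    has, whereas \<open>q\<close> is tied to \<open>f\<close> up to length \<open>n\<close>. The
    bounds keep the words on the right-hand side within that range.\<close>
  have cast: "complex_of_real (\<Sum>i<r. (\<Sum>j<r. q (w j @ s) * H j i) * q (t @ v i)) =
      (\<Sum>i<r. (\<Sum>j<r. f (w j @ s) * H' j i) * f (t @ v i))"
    if "length s + (d - 1) \<le> n" "length t + (d - 1) \<le> n" for s t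
  proof -
    have "complex_of_real (q (w j @ s)) = f (w j @ s)" if "j < r" for j
      using w[OF that] \<open>length s + (d - 1) \<le> n\<close> by (intro q) (simp add: words_le_def)
    moreover have "complex_of_real (q (t @ v i)) = f (t @ v i)" if "i < r" for i
      using v[OF that] \<open>length t + (d - 1) \<le> n\<close> by (intro q) (simp add: words_le_def)
    ultimately show ?thesis by (simp add: H'_def)
  qed
  have "f (t @ s) = (\<Sum>i<r. (\<Sum>j<r. f (w j @ s) * H' j i) * f (t @ v i))"
    if "length s < d" "length t < d" for s t
  proof -
    have "s \<in> words_le (d - 1)" "t \<in> words_le (d - 1)" using that by (auto simp: words_le_def)
    from hankel_skeleton[OF v w _ H this]
    have "q (t @ s) = (\<Sum>i<r. (\<Sum>j<r. q (w j @ s) * H j i) * q (t @ v i))"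
      by (simp add: r_def)
    moreover have "length (t @ s) \<le> n" using that k m km by simp
    ultimately show ?thesis using q[of "t @ s"] cast[of s t] that k m km by simp
  qed
  note ext = skeleton_extends[where f = f and R = R and C = C and w = w and H = H' and v = v, OF fac this]
  have "q (t @ s) = (\<Sum>i<r. (\<Sum>j<r. q (w j @ s) * H j i) * q (t @ v i))"
    if "s \<in> words_le k" "t \<in> words_le m" for s t
  proof -
    have "complex_of_real (q (t @ s)) =
        complex_of_real (\<Sum>i<r. (\<Sum>j<r. q (w j @ s) * H j i) * q (t @ v i))"
      using that k m km q[of "t @ s"] ext[of t s] cast[of s t] by (simp add: words_le_def)
    then show ?thesis by (simp only: of_real_eq_iff)
  qed
  then show "mat_rank (hankel q k m) \<le> mat_rank (hankel q (d - 1) (d - 1))"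
    unfolding r_def[symmetric] by (rule hankel_rank_le_of_factorization)
qed

section \<open>Sufficiency: a parameter tuple from skeleton decompositions\<close>

lemma sum_zero_padding:
  fixes g :: "nat \<Rightarrow> 'b::comm_monoid_add"
  assumes "r \<le> d" and "\<And>i. i < r \<Longrightarrow> h i = g i" and "\<And>i. r \<le> i \<Longrightarrow> i < d \<Longrightarrow> h i = 0"
  shows "(\<Sum>i<d. h i) = (\<Sum>i<r. g i)"
  using assms by (intro sum.mono_neutral_cong_right) auto

text \<open>\<open>c\<close> and \<open>m\<close> stand for the larger and smaller half of
  \<open>n\<close>. \<open>E1\<close> drives the recursion for the column vectors
  \<open>T\<^sub>t x\<close>, \<open>E2\<close> the one for the row vectors
  \<open>y\<^sup>T T\<^sub>s\<close>.\<close>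

lemma realization_exists:
  fixes q :: "'a::finite list \<Rightarrow> real" and r :: nat
  assumes snoc: "\<And>u. length u < n \<Longrightarrow> q u = (\<Sum>a\<in>UNIV. q (u @ [a]))"
    and n: "c + m = n" and cm: "c \<le> Suc m" and d: "d \<ge> 1" "d \<le> c" "r \<le> d"
    and v: "\<And>i. i < r \<Longrightarrow> v i \<in> words_le (d - 1)" and w: "\<And>j. j < r \<Longrightarrow> w j \<in> words_le (d - 1)"
    and E1: "\<And>s t. s \<in> words_le c \<Longrightarrow> t \<in> words_le m \<Longrightarrow>
      q (t @ s) = (\<Sum>i<r. (\<Sum>j<r. q (w j @ s) * H j i) * q (t @ v i))"
    and E2: "\<And>s t. s \<in> words_le m \<Longrightarrow> t \<in> words_le c \<Longrightarrow>
      q (t @ s) = (\<Sum>i<r. (\<Sum>j<r. q (w j @ s) * H j i) * q (t @ v i))"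
  obtains T x y where "(T, x, y) \<in> param_space d"
    and "\<And>u. u \<in> words n \<Longrightarrow> y \<bullet> (word_mat d T u *\<^sub>v x) = complex_of_real (q u)"
proof -
  define \<tau> where "\<tau> a i k = (\<Sum>j<r. q (w j @ a # v i) * H j k)" for a i k
  \<comment> \<open>\<open>\<rho> u\<close> is the nonzero part of the row vector
    \<open>y\<^sup>T T\<^sub>u\<close> claimed in \<open>costate\<close>; the empty word gives
    \<open>y\<close>.\<close>
  define \<rho> where "\<rho> u i = (\<Sum>j<r. q (w j @ u) * H j i)" for u i
  define T where "T a = mat d d (\<lambda>(i, k). if i < r \<and> k < r then complex_of_real (\<tau> a i k) else 0)" for a
  define x where "x = vec d (\<lambda>i. if i < r then complex_of_real (q (v i)) else 0)"
  define y where "y = vec d (\<lambda>i. if i < r then complex_of_real (\<rho> [] i) else 0)"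
  have T: "T a \<in> carrier_mat d d" for a by (simp add: T_def)
  have x: "x \<in> carrier_vec d" and y: "y \<in> carrier_vec d" by (simp_all add: x_def y_def)
  note W = word_mat_carrier[of T, OF T]

  \<comment> \<open>\<open>E1\<close> is only available for \<open>t\<close> of length at most \<open>m\<close>, so the state recursion reaches length \<open>m + 1\<close>;
    as \<open>c \<le> m + 1\<close>, this suffices for the first half of a word of length \<open>n\<close>.\<close>
  have state: "word_mat d T u *\<^sub>v x = vec d (\<lambda>i. if i < r then complex_of_real (q (u @ v i)) else 0)"
    if "length u \<le> Suc m" for u
    using that
  proof (induction u rule: rev_induct)
    case Nil
    show ?case unfolding append_Nil x_def[symmetric] using x by simp
  next
    case (snoc a u)
    let ?z = "vec d (\<lambda>i. if i < r then complex_of_real (q (u @ v i)) else 0)"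
    have "word_mat d T (u @ [a]) *\<^sub>v x = T a *\<^sub>v (word_mat d T u *\<^sub>v x)"
      using T[of a] W x by (simp add: word_mat_snoc assoc_mult_mat_vec[of _ d d _ d])
    also have "word_mat d T u *\<^sub>v x = ?z" using snoc by simp
    also have "T a *\<^sub>v ?z = vec d (\<lambda>i. if i < r then complex_of_real (q ((u @ [a]) @ v i)) else 0)"
    proof (rule eq_vecI)
      fix i assume "i < dim_vec (vec d (\<lambda>i. if i < r then complex_of_real (q ((u @ [a]) @ v i)) else 0))"
      then have i: "i < d" by simp
      have "(T a *\<^sub>v ?z) $ i = (\<Sum>k<d. T a $$ (i, k) * ?z $ k)"
        using i by (simp add: T_def scalar_prod_def atLeast0LessThan)
      also have "\<dots> = (if i < r then complex_of_real (q ((u @ [a]) @ v i)) else 0)"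
      proof (cases "i < r")
        case True
        have "(\<Sum>k<d. T a $$ (i, k) * ?z $ k) = (\<Sum>k<d. if k < r then complex_of_real (\<tau> a i k * q (u @ v k)) else 0)"
          using i True by (intro sum.cong) (auto simp: T_def)
        also have "\<dots> = (\<Sum>k<r. complex_of_real (\<tau> a i k * q (u @ v k)))"
          using d by (intro sum_zero_padding) auto
        also have "\<dots> = complex_of_real (\<Sum>k<r. \<tau> a i k * q (u @ v k))" by simp
        also have "(\<Sum>k<r. \<tau> a i k * q (u @ v k)) = q (u @ (a # v i))"
          unfolding \<tau>_def using snoc.prems v[OF True] d
          by (intro E1[symmetric]) (auto simp: words_le_def)
        finally show ?thesis using True by simp
      next
        case False
        then show ?thesis using i by (simp add: T_def)
      qed
      finally show "(T a *\<^sub>v ?z) $ i = vec d (\<lambda>i. if i < r then complex_of_real (q ((u @ [a]) @ v i)) else 0) $ i"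
        using i by simp
    qed (simp add: T_def)
    finally show ?case .
  qed

  \<comment> \<open>Dual to \<open>state\<close>: a row vector is multiplied from the right, so the
    induction prepends letters.\<close>
  have costate: "(\<Sum>k<d. y $ k * word_mat d T u $$ (k, i)) = (if i < r then complex_of_real (\<rho> u i) else 0)"
    if "length u \<le> Suc m" "i < d" for u i
    using that
  proof (induction u arbitrary: i)
    case Nil
    then show ?case
      by (simp add: y_def if_distrib[of "\<lambda>z. _ * z"] sum.delta' cong: if_cong)
  next
    case (Cons a u)
    have W': "word_mat d T (a # u) = word_mat d T u * T a"
      using word_mat_append[of T d "[a]" u, OF T] word_mat_snoc[of d T "[]" a] T[of a] by simp
    have "(\<Sum>k<d. y $ k * word_mat d T (a # u) $$ (k, i)) =
        (\<Sum>k<d. y $ k * (\<Sum>l<d. word_mat d T u $$ (k, l) * T a $$ (l, i)))"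
      using Cons.prems W[of u] T[of a] unfolding W'
      by (intro sum.cong refl) (auto simp: scalar_prod_def atLeast0LessThan)
    also have "\<dots> = (\<Sum>l<d. (\<Sum>k<d. y $ k * word_mat d T u $$ (k, l)) * T a $$ (l, i))"
      unfolding sum_distrib_left sum_distrib_right by (subst sum.swap) (simp only: mult.assoc)
    also have "\<dots> = (\<Sum>l<d. (if l < r then complex_of_real (\<rho> u l) else 0) * T a $$ (l, i))"
      using Cons by (intro sum.cong) auto
    also have "\<dots> = (if i < r then complex_of_real (\<rho> (a # u) i) else 0)"
    proof (cases "i < r")
      case True
      have "(\<Sum>l<d. (if l < r then complex_of_real (\<rho> u l) else 0) * T a $$ (l, i)) =
          (\<Sum>l<d. if l < r then complex_of_real (\<rho> u l * \<tau> a l i) else 0)"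
        using Cons.prems True by (intro sum.cong) (auto simp: T_def)
      also have "\<dots> = (\<Sum>l<r. complex_of_real (\<rho> u l * \<tau> a l i))"
        using d by (intro sum_zero_padding) auto
      also have "\<dots> = complex_of_real (\<Sum>l<r. \<rho> u l * \<tau> a l i)" by simp
      also have "(\<Sum>l<r. \<rho> u l * \<tau> a l i) = (\<Sum>j<r. (\<Sum>l<r. \<rho> u l * q ((w j @ [a]) @ v l)) * H j i)"
        unfolding \<tau>_def sum_distrib_left sum_distrib_right
        by (subst sum.swap) (simp add: mult.assoc)
      also have "\<dots> = (\<Sum>j<r. q ((w j @ [a]) @ u) * H j i)"
      proof (rule sum.cong[OF refl])
        fix j assume "j \<in> {..<r}"
        then have "w j @ [a] \<in> words_le c" "u \<in> words_le m"
          using w[of j] d Cons.prems by (auto simp: words_le_def)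
        \<comment> \<open>The extra letter joins the prefix \<open>w j\<close>, making its length at
          most \<open>d\<close>; this is where \<open>d \<le> c\<close> matters.\<close>
        from E2[OF this(2,1)] show "(\<Sum>l<r. \<rho> u l * q ((w j @ [a]) @ v l)) * H j i = q ((w j @ [a]) @ u) * H j i"
          by (simp add: \<rho>_def)
      qed
      finally show ?thesis using True by (simp add: \<rho>_def)
    next
      case False
      then show ?thesis using Cons.prems by (simp add: T_def)
    qed
    finally show ?case .
  qed

  \<comment> \<open>Invariance of \<open>y\<close> reduces, by \<open>costate\<close> at one-letter
    words, to summing out a letter after each \<open>w k\<close>, whose length is below
    \<open>n\<close>.\<close>
  have "(\<Sum>a\<in>UNIV. \<Sum>i<d. y $ i * T a $$ (i, j)) = y $ j" if j: "j < d" for j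
  proof -
    have "(\<Sum>i<d. y $ i * T a $$ (i, j)) = (if j < r then complex_of_real (\<rho> [a] j) else 0)" for a
      using costate[of "[a]" j] j word_mat_snoc[of d T "[]" a] T[of a] by simp
    moreover have "(\<Sum>a\<in>UNIV. \<rho> [a] j) = \<rho> [] j"
    proof -
      have "(\<Sum>a\<in>UNIV. \<rho> [a] j) = (\<Sum>k<r. (\<Sum>a\<in>UNIV. q (w k @ [a])) * H k j)"
        unfolding \<rho>_def sum_distrib_right by (rule sum.swap)
      also have "\<dots> = (\<Sum>k<r. q (w k) * H k j)"
      proof (rule sum.cong[OF refl])
        fix k assume "k \<in> {..<r}"
        then have "length (w k) < n" using w[of k] d n by (simp add: words_le_def)
        then show "(\<Sum>a\<in>UNIV. q (w k @ [a])) * H k j = q (w k) * H k j" by (simp flip: snoc)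
      qed
      finally show ?thesis by (simp add: \<rho>_def)
    qed
    ultimately show ?thesis using j by (simp add: y_def flip: of_real_sum)
  qed
  then have "(T, x, y) \<in> param_space d"
    using T x y row_invariant_iff[OF y, of T] by (simp add: param_space_def)
  moreover have "y \<bullet> (word_mat d T u *\<^sub>v x) = complex_of_real (q u)" if "u \<in> words n" for u
  proof -
    \<comment> \<open>The cut after \<open>c\<close> letters matches both recursions:
      \<open>c \<le> Suc m\<close> for \<open>state\<close> on \<open>t\<close>, and length
      \<open>m\<close> for \<open>costate\<close> on \<open>s\<close>.\<close>
    define t where "t = take c u"
    define s where "s = drop c u"
    have u: "u = t @ s" by (simp add: t_def s_def)
    have len: "length t = c" "length s = m" using that n by (simp_all add: t_def s_def words_def)
    have "word_mat d T u *\<^sub>v x = word_mat d T s *\<^sub>v (word_mat d T t *\<^sub>v x)"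
      unfolding u word_mat_append[of T, OF T] using W x by (simp add: assoc_mult_mat_vec[of _ d d _ d])
    also have "word_mat d T t *\<^sub>v x = vec d (\<lambda>i. if i < r then complex_of_real (q (t @ v i)) else 0)"
      using len cm by (intro state) simp
    finally have "y \<bullet> (word_mat d T u *\<^sub>v x) = (\<Sum>k<d. (\<Sum>i<d. y $ i * word_mat d T s $$ (i, k)) *
        vec d (\<lambda>i. if i < r then complex_of_real (q (t @ v i)) else 0) $ k)"
      using scalar_prod_mult_mat_vec[OF W y] by simp
    also have "\<dots> = (\<Sum>k<r. complex_of_real (\<rho> s k * q (t @ v k)))"
      using d len costate by (intro sum_zero_padding) auto
    also have "\<dots> = complex_of_real (\<Sum>k<r. \<rho> s k * q (t @ v k))" by simp
    also have "(\<Sum>k<r. \<rho> s k * q (t @ v k)) = q (t @ s)"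
      unfolding \<rho>_def using len by (intro E2[symmetric]) (auto simp: words_le_def)
    finally show ?thesis using u by simp
  qed
  ultimately show ?thesis by (rule that)
qed

section \<open>The equivalence\<close>

theorem theorem3p1:
  fixes p :: "'a::finite list \<Rightarrow> real" and d n :: nat
  assumes "d \<ge> 1" and "n \<ge> 2 * d - 1"
    and "\<And>v. v \<in> words n \<Longrightarrow> p v \<ge> 0"
  shows "((\<lambda>v\<in>words n. complex_of_real (p v)) \<in> model_map n d ` param_space d \<longleftrightarrow>
            minors_vanish (marginal n p) d \<and>
            mat_rank (hankel (marginal n p) (nat \<lceil>real n / 2\<rceil>) (nat \<lfloor>real n / 2\<rfloor>)) =
              mat_rank (hankel (marginal n p) (nat \<lfloor>real n / 2\<rfloor>) (nat \<lceil>real n / 2\<rceil>)) \<and>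
            mat_rank (hankel (marginal n p) (nat \<lfloor>real n / 2\<rfloor>) (nat \<lceil>real n / 2\<rceil>)) =
              mat_rank (hankel (marginal n p) (d - 1) (d - 1))) \<and>
         (minors_vanish (marginal n p) d \<longleftrightarrow>
            mat_rank (hankel (marginal n p) (d - 1) (d - 1)) \<le> d)"
proof -
  define c where "c = nat \<lceil>real n / 2\<rceil>"
  define m where "m = nat \<lfloor>real n / 2\<rfloor>"
  let ?q = "marginal n p"
  have m: "m = n div 2"
    unfolding m_def using floor_divide_of_nat_eq[of n 2, where 'a = real] by simp
  have c: "c = n - n div 2"
    unfolding c_def by linarith
  \<comment> \<open>The bound on \<open>n\<close> enters here: both halves are at least
    \<open>d - 1\<close>, and the larger one is at least \<open>d\<close>.\<close>
  have cm: "c + m = n" "c \<le> Suc m" "m \<le> c" "d \<le> c" "d - 1 \<le> m"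
    using assms(1,2) unfolding c m by linarith+
  let ?in = "(\<lambda>v\<in>words n. complex_of_real (p v)) \<in> model_map n d ` param_space d"
  have "minors_vanish ?q d \<and> mat_rank (hankel ?q c m) = mat_rank (hankel ?q (d - 1) (d - 1)) \<and>
      mat_rank (hankel ?q m c) = mat_rank (hankel ?q (d - 1) (d - 1))" if ?in
  proof -
    from that obtain T x y where par: "(T, x, y) \<in> param_space d"
      and eq: "(\<lambda>v\<in>words n. complex_of_real (p v)) = (\<lambda>v\<in>words n. y \<bullet> (word_mat d T v *\<^sub>v x))"
      by (auto simp: model_map_def)
    have top: "complex_of_real (p v) = y \<bullet> (word_mat d T v *\<^sub>v x)" if "v \<in> words n" for v
      using fun_cong[OF eq, of v] that by simp
    have T: "\<And>a. T a \<in> carrier_mat d d" and x: "x \<in> carrier_vec d" and y: "y \<in> carrier_vec d"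
      using par by (auto simp: param_space_def)
    note W = word_mat_carrier[of T, OF T]
    define f where "f u = y \<bullet> (word_mat d T u *\<^sub>v x)" for u
    have fac: "f (w @ v) = (\<Sum>k<d. (\<Sum>i<d. y $ i * word_mat d T v $$ (i, k)) * (word_mat d T w *\<^sub>v x) $ k)"
      for v w
    proof -
      have "f (w @ v) = y \<bullet> (word_mat d T v *\<^sub>v (word_mat d T w *\<^sub>v x))"
        unfolding f_def word_mat_append[of T, OF T] using W x
        by (simp add: assoc_mult_mat_vec[of _ d d _ d])
      also have "\<dots> = (\<Sum>k<d. (\<Sum>i<d. y $ i * word_mat d T v $$ (i, k)) * (word_mat d T w *\<^sub>v x) $ k)"
        by (rule scalar_prod_mult_mat_vec[OF W y mult_mat_vec_carrier[OF W x]])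
      finally show ?thesis .
    qed
    have q: "complex_of_real (?q u) = f u" if "length u \<le> n" for u
      unfolding f_def by (rule model_marginal[OF par top that])
    have rank: "mat_rank (hankel ?q k l) = mat_rank (hankel ?q (d - 1) (d - 1))"
      if "d - 1 \<le> k" "d - 1 \<le> l" "k + l \<le> n" for k l
      using hankel_rank_of_realization[where f = f and R = "\<lambda>k v. \<Sum>i<d. y $ i * word_mat d T v $$ (i, k)" and
          C = "\<lambda>k w. (word_mat d T w *\<^sub>v x) $ k", OF fac q assms(1) that] .
    have "d - 1 \<le> c" "c + m \<le> n" "m + c \<le> n" using cm by simp_all
    moreover have "minors_vanish ?q d"
      using minors_vanish_of_realization[where f = f and R = "\<lambda>k v. \<Sum>i<d. y $ i * word_mat d T v $$ (i, k)" and
          C = "\<lambda>k w. (word_mat d T w *\<^sub>v x) $ k", OF fac q assms(2)] .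
    ultimately show ?thesis
      using rank[of c m] rank[of m c] cm by blast
  qed
  moreover have ?in if minors: "minors_vanish ?q d"
    and rank1: "mat_rank (hankel ?q c m) = mat_rank (hankel ?q (d - 1) (d - 1))"
    and rank2: "mat_rank (hankel ?q m c) = mat_rank (hankel ?q (d - 1) (d - 1))"
  proof -
    define r where "r = mat_rank (hankel ?q (d - 1) (d - 1))"
    have "r \<le> d" using minors by (simp add: minors_vanish_iff_rank_le r_def)
    obtain v w where v: "\<And>i. i < r \<Longrightarrow> v i \<in> words_le (d - 1)"
      and w: "\<And>j. j < r \<Longrightarrow> w j \<in> words_le (d - 1)"
      and det: "det (mat r r (\<lambda>(i, j). ?q (w j @ v i))) \<noteq> 0"
      unfolding r_def using hankel_rank_minor[of ?q "d - 1" "d - 1"] by blast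
    from inverse_entries[OF det] obtain H where
      H: "\<And>i k. i < r \<Longrightarrow> k < r \<Longrightarrow> (\<Sum>j<r. H i j * ?q (w k @ v j)) = of_bool (i = k)" by blast
    have mono: "words_le (d - 1) \<subseteq> words_le k" if "d - 1 \<le> k" for k
      using that by (auto simp: words_le_def)
    \<comment> \<open>One short-word minor and one \<open>H\<close> serve both half-length matrices,
      as each has rank \<open>r\<close> and contains all words of length at most
      \<open>d - 1\<close>.\<close>
    have skel: "?q (t @ s) = (\<Sum>i<r. (\<Sum>j<r. ?q (w j @ s) * H j i) * ?q (t @ v i))"
      if "d - 1 \<le> k" "d - 1 \<le> l" "mat_rank (hankel ?q k l) \<le> r" "s \<in> words_le k" "t \<in> words_le l" for k l s t
      using mono[OF that(1)] mono[OF that(2)] v w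
      by (intro hankel_skeleton[OF _ _ that(3) H that(4,5)]) auto
    obtain T x y where par: "(T, x, y) \<in> param_space d"
      and val: "\<And>u. u \<in> words n \<Longrightarrow> y \<bullet> (word_mat d T u *\<^sub>v x) = complex_of_real (?q u)"
    proof (rule realization_exists[of n ?q c m d r v w H])
      show "?q (t @ s) = (\<Sum>i<r. (\<Sum>j<r. ?q (w j @ s) * H j i) * ?q (t @ v i))"
        if "s \<in> words_le c" "t \<in> words_le m" for s t
        by (rule skel[OF _ _ _ that]) (use cm rank1 in \<open>simp_all add: r_def\<close>)
      show "?q (t @ s) = (\<Sum>i<r. (\<Sum>j<r. ?q (w j @ s) * H j i) * ?q (t @ v i))"
        if "s \<in> words_le m" "t \<in> words_le c" for s t
        by (rule skel[OF _ _ _ that]) (use cm rank2 in \<open>simp_all add: r_def\<close>)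
    qed (use marginal_snoc v w cm assms(1) \<open>r \<le> d\<close> in auto)
    have "(\<lambda>v\<in>words n. complex_of_real (p v)) = model_map n d (T, x, y)"
      using val by (auto simp: model_map_def marginal_full words_def restrict_def)
    with par show ?in by blast
  qed
  ultimately show ?thesis
    unfolding c_def[symmetric] m_def[symmetric] minors_vanish_iff_rank_le by metis
qed

end
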